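(* Let $\mathscr{S}^2$ be the set of gap-frequency partitions in which each part appears at most $2$ times, and for $i\in\{0,1,2\}$ let $\mathscr{S}^2_i$ be the set of partitions in $\mathscr{S}^2$ in which at most $i$ of the parts are equal to $1$ (so $\mathscr{S}^2_2=\mathscr{S}^2$). Then, as formal power series in $x,y,q$, \begin{align*} \sum_{\lambda\in\mathscr{S}^2}x^{\ell(\lambda)}y^{\ell_2(\lambda)}q^{|\lambda|}&=\sum_{n_1,n_2\geq 0}\frac{x^{n_1+2n_2}y^{n_2}q^{\binom{n_1}{2}+4\binom{n_2}{2}+2n_1n_2+n_1+2n_2}}{(q;q)_{n_1}(q^2;q^2)_{n_2}},\\ \sum_{\lambda\in\mathscr{S}^2_1}x^{\ell(\lambda)}y^{\ell_2(\lambda)}q^{|\lambda|}&=\sum_{n_1,n_2\geq 0}\frac{x^{n_1+2n_2}y^{n_2}q^{\binom{n_1}{2}+4\binom{n_2}{2}+2n_1n_2+n_1+4n_2}}{(q;q)_{n_1}(q^2;q^2)_{n_2}},\\ \sum_{\lambda\in\mathscr{S}^2_0}x^{\ell(\lambda)}y^{\ell_2(\lambda)}q^{|\lambda|}&=\sum_{n_1,n_2\geq 0}\frac{x^{n_1+2n_2}y^{n_2}q^{\binom{n_1}{2}+4\binom{n_2}{2}+2n_1n_2+2n_1+4n_2}}{(q;q)_{n_1}(q^2;q^2)_{n_2}}. \end{align*}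
   Context: A partition $\lambda$ is a finite non-decreasing sequence of positive integers (its parts), the empty partition being allowed; $|\lambda|$ is the sum of its parts and $\ell(\lambda)$ is the number of its parts counted with multiplicity. For $m\geq 2$, $\ell_m(\lambda)$ is the number of parts repeated exactly $m$ times, i.e. the number of distinct integers $a$ that occur exactly $m$ times as a part of $\lambda$ (so e.g. $\ell_2(1+1)=1$). A partition is a gap-frequency partition if, whenever a part $a$ appears exactly $i$ times (with $i\ge 1$), the next strictly larger part (if any) is at least $a+i$, and if that next larger part is exactly $a+i$ then it appears at most $i$ times. For $n\ge 0$, $(A;q)_n=\prod_{j=0}^{n-1}(1-Aq^j)$; thus $(q^m;q^m)_n=\prod_{j=1}^{n}(1-q^{mj})$. *)

theory Defs
  imports "HOL-Analysis.Analysis"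
begin

definition is_partition :: "nat list \<Rightarrow> bool" where
  "is_partition p \<longleftrightarrow> sorted p \<and> (\<forall>a\<in>set p. 0 < a)"

definition num_repeated :: "nat \<Rightarrow> nat list \<Rightarrow> nat" where
  "num_repeated m p = card {a \<in> set p. count_list p a = m}"

definition next_part :: "nat list \<Rightarrow> nat \<Rightarrow> nat \<Rightarrow> bool" where
  "next_part p a b \<longleftrightarrow>
     a \<in> set p \<and> b \<in> set p \<and> a < b \<and> \<not> (\<exists>c\<in>set p. a < c \<and> c < b)"

definition gap_frequency :: "nat list \<Rightarrow> bool" where
  "gap_frequency p \<longleftrightarrow>
     (\<forall>a b. next_part p a b \<longrightarrow>
        a + count_list p a \<le> b \<and>
        (b = a + count_list p a \<longrightarrow> count_list p b \<le> count_list p a))"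

definition gf_partitions :: "nat \<Rightarrow> nat list set" where
  "gf_partitions k =
     {p. is_partition p \<and> gap_frequency p \<and> (\<forall>a\<in>set p. count_list p a \<le> k)}"

definition gf_partitions_ones :: "nat \<Rightarrow> nat \<Rightarrow> nat list set" where
  "gf_partitions_ones k i = {p \<in> gf_partitions k. count_list p 1 \<le> i}"

definition q_pochhammer :: "'a::comm_ring_1 \<Rightarrow> 'a \<Rightarrow> nat \<Rightarrow> 'a" where
  "q_pochhammer A q n = (\<Prod>j<n. 1 - A * q ^ j)"

text \<open>
  Formal power series in three variables are iterated univariate ones, with \<open>q\<close> as the outermost
  variable, \<open>x\<close> in the middle and \<open>y\<close> innermost. The metric topology on the outermost \<open>fps\<close>
  is the \<open>q\<close>-adic one with discrete coefficients: a family has a sum in the sense of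
  \<open>has_sum\<close> iff every coefficient of a power of \<open>q\<close> (itself a series in \<open>x\<close> and \<open>y\<close>)
  is nonzero for only finitely many members, so such a sum is in particular a sum of formal power
  series in \<open>x\<close>, \<open>y\<close>, \<open>q\<close>. With another variable outermost the sums over partitions would
  not converge, as the coefficient ring carries the discrete topology.
\<close>

type_synonym fps3 = "rat fps fps fps"

definition var_q :: fps3 where "var_q = fps_X"

definition var_x :: fps3 where "var_x = fps_const fps_X"

definition var_y :: fps3 where "var_y = fps_const (fps_const fps_X)"

definition partition_weight :: "nat list \<Rightarrow> fps3" where
  "partition_weight p = var_x ^ length p * var_y ^ num_repeated 2 p * var_q ^ sum_list p"

text \<open>
  The coefficient ring of the outermost series is not a field. Division in \<open>fps3\<close> is nevertheless
  the genuine one for the denominators in use, since their constant coefficient in \<open>q\<close> is 1.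
\<close>

lemma q_pochhammer_nth_0:
  assumes "m > 0"
  shows "fps_nth (q_pochhammer (var_q ^ m) (var_q ^ m) n) 0 = 1"
  using assms by (induction n) (simp_all add: q_pochhammer_def var_q_def)

lemma fps3_divide_times:
  fixes f g :: fps3
  assumes "fps_nth g 0 = 1"
  shows "f / g * g = f"
proof -
  have u: "unit_factor g = g" "subdegree g = 0"
    using assms by (simp_all add: subdegree_eq_0)
  have "inverse (1 :: rat fps fps) = 1"
    by (intro fps_inverse_one' fps_inverse_one) simp
  hence "inverse g * g = 1"
    unfolding fps_inverse_def using assms by (intro fps_left_inverse'[of 1]) simp_all
  thus ?thesis
    unfolding fps_divide_def u by (simp add: mult.assoc)
qed

end

theory Submission
  imports Defs
begin

unbundle no vec_syntax and fps_syntax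

text \<open>
  With at most two copies of each part, the gap-frequency condition says that the multiplicities
  \<open>f\<close> satisfy \<open>f a + f (a + 1) \<le> 2\<close> for all \<open>a\<close>. Let \<open>G k i\<close> count those partitions all of whose
  parts exceed \<open>k\<close> and in which \<open>k + 1\<close> occurs at most \<open>i\<close> times. Removing the copies of \<open>k + 1\<close>
  gives
  \<open>G k 0 = G (k + 1) 2\<close>, \<open>G k 1 = G (k + 1) 2 + x q^(k + 1) G (k + 1) 1\<close> and
  \<open>G k 2 = G k 1 + x\<^sup>2 y q^(2 k + 2) G (k + 2) 2\<close>.
  Let \<open>H a b\<close> be the double sum whose exponent of \<open>q\<close> has linear part \<open>a n1 + b n2\<close>. Splitting off
  a factor \<open>1 - q^n1\<close> or \<open>1 - q^(2 n2)\<close> shows that \<open>H (1 + k) (4 + 2 k)\<close> and \<open>H (1 + k) (2 + 2 k)\<close>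
  satisfy the recurrences of \<open>G k 1\<close> and \<open>G k 2\<close>. All of these series are 1 modulo \<open>q^(k + 1)\<close>, and
  the recurrences then determine the coefficient of \<open>q^n\<close> by induction on \<open>n - k\<close>.
\<close>

section \<open>Topology of formal power series\<close>

lemma eventually_nhds_prod_fps_nth:
  fixes f g :: "'a::group_add fps"
  shows "\<forall>\<^sub>F p in nhds f \<times>\<^sub>F nhds g. fst p $ n = f $ n \<and> snd p $ n = g $ n"
  using filterlim_fst[of "nhds f" "nhds g"] filterlim_snd[of "nhds g" "nhds f"]
  unfolding tendsto_fps_iff by (intro eventually_conj) auto

text \<open>Continuity of addition is what the rules for adding sums and for disjoint index sets ask
  for. Convergence means that each coefficient eventually equals that of the limit, and coefficient
  \<open>n\<close> of a sum depends only on coefficient \<open>n\<close> of the summands.\<close>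

instance fps :: (ab_group_add) topological_comm_monoid_add
proof
  fix f g :: "'a fps"
  have "\<forall>\<^sub>F p in nhds f \<times>\<^sub>F nhds g. (fst p + snd p) $ n = (f + g) $ n" for n
    by (rule eventually_mono[OF eventually_nhds_prod_fps_nth[of n]]) simp
  thus "((\<lambda>p. fst p + snd p) \<longlongrightarrow> f + g) (nhds f \<times>\<^sub>F nhds g)"
    unfolding tendsto_fps_iff by blast
qed

text \<open>Allows a constant factor to be moved into a sum. Coefficient \<open>n\<close> of a
  product involves only coefficients up to \<open>n\<close>, so finitely many eventual equalities
  have to hold at once.\<close>

instance fps :: (ring) topological_semigroup_mult
proof
  fix f g :: "'a fps"
  have ev: "\<forall>\<^sub>F p in nhds f \<times>\<^sub>F nhds g. fst p $ n = f $ n \<and> snd p $ n = g $ n" for n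
    by (rule eventually_nhds_prod_fps_nth)
  have near: "\<forall>\<^sub>F p in nhds f \<times>\<^sub>F nhds g. \<forall>i\<in>{..n}. fst p $ i = f $ i \<and> snd p $ i = g $ i" for n
    by (intro eventually_ball_finite ballI ev) auto
  have "\<forall>\<^sub>F p in nhds f \<times>\<^sub>F nhds g. (fst p * snd p) $ n = (f * g) $ n" for n
    by (rule eventually_mono[OF near[of n]]) (auto simp: fps_mult_nth intro!: sum.cong)
  thus "((\<lambda>p. fst p * snd p) \<longlongrightarrow> f * g) (nhds f \<times>\<^sub>F nhds g)"
    unfolding tendsto_fps_iff by blast
qed

text \<open>The candidate limit collects, for each \<open>n\<close>, the finitely many nonzero
  coefficients; every finite index set containing that support already gives the same value.\<close>

lemma fps_summable_on:
  fixes f :: "'a \<Rightarrow> 'b::ab_group_add fps"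
  assumes "\<And>n. finite {a\<in>A. f a $ n \<noteq> 0}"
  shows "f summable_on A"
  unfolding summable_on_def has_sum_def
proof (intro exI tendsto_fpsI)
  fix n
  let ?S = "{a\<in>A. f a $ n \<noteq> 0}"
  show "\<forall>\<^sub>F X in finite_subsets_at_top A.
          sum f X $ n = Abs_fps (\<lambda>n. \<Sum>a\<in>{a\<in>A. f a $ n \<noteq> 0}. f a $ n) $ n"
    unfolding eventually_finite_subsets_at_top
    using assms[of n]
    by (intro exI[of _ ?S]) (auto simp: fps_sum_nth intro!: sum.mono_neutral_right)
qed

text \<open>Yields the initial values: in low degree only the empty partition, respectively the
  index \<open>(0, 0)\<close>, contributes.\<close>

lemma fps_has_sum_nth_single:
  fixes f :: "'a \<Rightarrow> 'b::ab_group_add fps"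
  assumes "(f has_sum F) A" and "a \<in> A" and "\<And>b. b \<in> A \<Longrightarrow> b \<noteq> a \<Longrightarrow> f b $ n = 0"
  shows "F $ n = f a $ n"
proof -
  have "\<forall>\<^sub>F X in finite_subsets_at_top A. sum f X $ n = F $ n"
    using assms(1) unfolding has_sum_def tendsto_fps_iff by (rule spec)
  then obtain X where X: "finite X" "X \<subseteq> A"
    and eq: "\<forall>Y. finite Y \<and> X \<subseteq> Y \<and> Y \<subseteq> A \<longrightarrow> sum f Y $ n = F $ n"
    unfolding eventually_finite_subsets_at_top by (elim exE conjE)
  \<comment> \<open>The set \<open>X\<close> supplied by convergence need not contain
    \<open>a\<close>; enlarging it keeps the equality.\<close>
  have "sum f (insert a X) $ n = F $ n"
    by (rule eq[rule_format]) (use X assms(2) in auto)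
  hence "F $ n = (\<Sum>b\<in>insert a X. f b $ n)"
    by (simp only: fps_sum_nth)
  also have "\<dots> = (\<Sum>b\<in>{a}. f b $ n)"
    using X assms(2,3) by (intro sum.mono_neutral_right) auto
  finally show ?thesis by simp
qed

section \<open>Partitions with bounded adjacent multiplicities\<close>

text \<open>The adjacency condition ranges over all \<open>a\<close>, parts or not, so it also
  bounds each single multiplicity by 2, and it makes no reference to the next part.\<close>

definition parts_above :: "nat \<Rightarrow> nat \<Rightarrow> nat list set" where
  "parts_above k i = {p. sorted p \<and> (\<forall>a\<in>set p. k < a) \<and>
     (\<forall>a. count_list p a + count_list p (Suc a) \<le> 2) \<and> count_list p (Suc k) \<le> i}"

text \<open>If \<open>a\<close> occurs once, the gap condition only says that \<open>a + 1\<close>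
  occurs at most once. If \<open>a\<close> occurs twice, it excludes \<open>a + 1\<close>, and its
  demand on \<open>a + 2\<close> is the general bound 2.\<close>

lemma gap_frequency_iff_adjacent:
  "gap_frequency p \<and> (\<forall>a\<in>set p. count_list p a \<le> 2) \<longleftrightarrow>
     (\<forall>a. count_list p a + count_list p (Suc a) \<le> 2)" (is "?L \<longleftrightarrow> ?R")
proof
  assume L: ?L
  show ?R
  proof
    fix a
    show "count_list p a + count_list p (Suc a) \<le> 2"
    proof (cases "a \<in> set p \<and> Suc a \<in> set p")
      case True
      hence "next_part p a (Suc a)" by (auto simp: next_part_def)
      with L have "a + count_list p a \<le> Suc a"
        "Suc a = a + count_list p a \<longrightarrow> count_list p (Suc a) \<le> count_list p a"
        unfolding gap_frequency_def by blast+
      moreover have "count_list p a \<noteq> 0" using True by (simp add: count_list_0_iff)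
      ultimately show ?thesis by auto
    next
      case False
      thus ?thesis using L
        by (metis add.right_neutral add_0 count_notin zero_le)
    qed
  qed
next
  assume R: ?R
  have le: "count_list p a \<le> 2" for a using R[rule_format, of a] by simp
  have "a + count_list p a \<le> b \<and> (b = a + count_list p a \<longrightarrow> count_list p b \<le> count_list p a)"
    if "next_part p a b" for a b
  proof -
    have ab: "a < b" "count_list p a \<noteq> 0" "count_list p b \<noteq> 0"
      using that by (auto simp: next_part_def count_list_0_iff)
    consider "count_list p a = 1" | "count_list p a = 2" using le[of a] ab by linarith
    thus ?thesis
    proof cases
      case 1
      thus ?thesis using ab R[rule_format, of a] by (auto simp: Suc_le_eq)
    next
      case 2
      hence "count_list p (Suc a) = 0" using R[rule_format, of a] by simp
      hence "b \<noteq> Suc a" using ab by auto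
      thus ?thesis using 2 ab le[of b] by auto
    qed
  qed
  thus ?L using le by (auto simp: gap_frequency_def)
qed

lemma gf_partitions_ones_eq: "gf_partitions_ones 2 i = parts_above 0 i"
  using gap_frequency_iff_adjacent
  by (auto simp: gf_partitions_ones_def gf_partitions_def parts_above_def is_partition_def)

lemma gf_partitions_eq: "gf_partitions 2 = parts_above 0 2"
proof -
  have "count_list p 1 \<le> 2" if "p \<in> gf_partitions 2" for p
    using that by (cases "1 \<in> set p") (auto simp: gf_partitions_def)
  hence "gf_partitions 2 = gf_partitions_ones 2 2" by (auto simp: gf_partitions_ones_def)
  thus ?thesis by (simp add: gf_partitions_ones_eq)
qed

text \<open>Without \<open>k + 1\<close> all parts exceed \<open>k + 1\<close>, and the bound 2 on
  the copies of \<open>k + 2\<close> follows from adjacency.\<close>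

lemma parts_above_0: "parts_above k 0 = parts_above (Suc k) 2"
proof -
  have "(\<forall>a\<in>set p. k < a) \<and> count_list p (Suc k) = 0 \<longleftrightarrow> (\<forall>a\<in>set p. Suc k < a)" for p
    by (auto simp: count_list_0_iff) (metis Suc_lessI)
  moreover have "\<forall>a. count_list p a + count_list p (Suc a) \<le> 2 \<Longrightarrow> count_list p (Suc (Suc k)) \<le> 2"
    for p by (metis add_leD2)
  ultimately show ?thesis unfolding parts_above_def le_zero_eq by blast
qed

lemma sorted_hd_eqI:
  assumes "sorted p" "\<forall>a\<in>set p. k < a" "count_list p (Suc k) \<noteq> 0"
  obtains r where "p = Suc k # r"
proof (cases p)
  case (Cons a r)
  have "Suc k \<in> set p" using assms(3) by (metis count_notin)
  hence "a = Suc k" using assms(1,2) Cons by auto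
  thus ?thesis using that Cons by blast
qed (use assms in simp)

text \<open>Case split on whether \<open>k + 1\<close> occurs. A single copy leaves room for at most
  one \<open>k + 2\<close>, which gives the index 1 in the second set.\<close>

lemma parts_above_1:
  "parts_above k 1 = parts_above (Suc k) 2 \<union> (#) (Suc k) ` parts_above (Suc k) 1"
proof (intro equalityI subsetI)
  fix p assume p: "p \<in> parts_above k 1"
  show "p \<in> parts_above (Suc k) 2 \<union> (#) (Suc k) ` parts_above (Suc k) 1"
  proof (cases "count_list p (Suc k) = 0")
    case True
    thus ?thesis using p by (auto simp: parts_above_0[symmetric]) (simp add: parts_above_def)
  next
    case False
    then obtain r where r: "p = Suc k # r"
      using p sorted_hd_eqI unfolding parts_above_def by blast
    have c: "count_list r a + count_list r (Suc a) \<le> 2" for a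
      using p r unfolding parts_above_def
      by (auto dest!: spec[of _ a] split: if_splits)
    have "count_list p (Suc k) + count_list p (Suc (Suc k)) \<le> 2" "count_list p (Suc k) \<le> 1"
      using p unfolding parts_above_def by blast+
    hence "count_list r (Suc k) = 0" "count_list r (Suc (Suc k)) \<le> 1" using r by auto
    moreover have "Suc k < a" if "a \<in> set r" for a
      using that calculation(1) p r
      by (metis (no_types, lifting) parts_above_def count_list_0_iff le_neq_implies_less
          mem_Collect_eq sorted_simps(2))
    ultimately have "r \<in> parts_above (Suc k) 1" using p r c by (auto simp: parts_above_def)
    thus ?thesis using r by blast
  qed
next
  fix p assume "p \<in> parts_above (Suc k) 2 \<union> (#) (Suc k) ` parts_above (Suc k) 1"
  thus "p \<in> parts_above k 1"
  proof
    assume "p \<in> parts_above (Suc k) 2"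
    thus ?thesis by (auto simp: parts_above_0[symmetric]) (simp add: parts_above_def)
  next
    assume "p \<in> (#) (Suc k) ` parts_above (Suc k) 1"
    then obtain r where r: "p = Suc k # r" "r \<in> parts_above (Suc k) 1" by blast
    \<comment> \<open>Prepending \<open>k + 1\<close> affects adjacency only at \<open>k\<close> and
      \<open>k + 1\<close>; these absences leave the sums 0 + 1 and 1 plus at most 1.\<close>
    hence "Suc k \<notin> set r" "k \<notin> set r" by (auto simp: parts_above_def)
    thus ?thesis using r by (fastforce simp: parts_above_def)
  qed
qed

text \<open>Two copies of \<open>k + 1\<close> use up the whole bound, so \<open>k + 2\<close> is
  absent and the remaining parts exceed \<open>k + 2\<close>.\<close>

lemma parts_above_2:
  "parts_above k 2 =
     parts_above k 1 \<union> (\<lambda>r. Suc k # Suc k # r) ` parts_above (Suc (Suc k)) 2"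
proof (intro equalityI subsetI)
  fix p assume p: "p \<in> parts_above k 2"
  show "p \<in> parts_above k 1 \<union> (\<lambda>r. Suc k # Suc k # r) ` parts_above (Suc (Suc k)) 2"
  proof (cases "count_list p (Suc k) \<le> 1")
    case True
    thus ?thesis using p by (simp add: parts_above_def)
  next
    case False
    then obtain s where s: "p = Suc k # s"
      using p sorted_hd_eqI[of p k] unfolding parts_above_def by fastforce
    then obtain r where "s = Suc k # r"
      using p False sorted_hd_eqI[of s k] unfolding parts_above_def by fastforce
    with s have r: "p = Suc k # Suc k # r" by simp
    have c: "count_list r a + count_list r (Suc a) \<le> 2" for a
      using p r unfolding parts_above_def
      by (auto dest!: spec[of _ a] split: if_splits)
    have "count_list p (Suc k) + count_list p (Suc (Suc k)) \<le> 2" "count_list p (Suc k) \<le> 2"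
      using p unfolding parts_above_def by blast+
    hence 0: "count_list r (Suc k) = 0" "count_list r (Suc (Suc k)) = 0" using r by auto
    have "Suc k < a" if "a \<in> set r" for a
      using that 0 p r
      by (metis (no_types, lifting) parts_above_def count_list_0_iff le_neq_implies_less
          mem_Collect_eq sorted_simps(2))
    hence "r \<in> parts_above (Suc k) 0" using p r c 0 by (auto simp: parts_above_def)
    thus ?thesis using r by (auto simp: parts_above_0)
  qed
next
  fix p assume "p \<in> parts_above k 1 \<union> (\<lambda>r. Suc k # Suc k # r) ` parts_above (Suc (Suc k)) 2"
  thus "p \<in> parts_above k 2"
  proof
    assume "p \<in> parts_above k 1"
    thus ?thesis by (auto simp: parts_above_def)
  next
    assume "p \<in> (\<lambda>r. Suc k # Suc k # r) ` parts_above (Suc (Suc k)) 2"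
    then obtain r where r: "p = Suc k # Suc k # r" "r \<in> parts_above (Suc (Suc k)) 2" by blast
    hence "Suc (Suc k) \<notin> set r" "Suc k \<notin> set r" "k \<notin> set r" by (auto simp: parts_above_def)
    thus ?thesis using r by (fastforce simp: parts_above_def)
  qed
qed

section \<open>Weights and generating functions of the partitions\<close>

lemma num_repeated_Cons:
  assumes "a \<notin> set p"
  shows "num_repeated 2 (a # p) = num_repeated 2 p"
proof -
  have "{x \<in> set (a # p). count_list (a # p) x = 2} = {x \<in> set p. count_list p x = 2}"
    using assms by auto
  thus ?thesis by (simp only: num_repeated_def)
qed

lemma num_repeated_Cons_Cons:
  assumes "a \<notin> set p"
  shows "num_repeated 2 (a # a # p) = Suc (num_repeated 2 p)"
proof -
  have "{x \<in> set (a # a # p). count_list (a # a # p) x = 2} =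
      insert a {x \<in> set p. count_list p x = 2}"
    using assms by auto
  thus ?thesis using assms by (simp only: num_repeated_def) simp
qed

lemma partition_weight_Cons:
  "a \<notin> set p \<Longrightarrow> partition_weight (a # p) = var_x * var_q ^ a * partition_weight p"
  by (simp add: partition_weight_def num_repeated_Cons power_add algebra_simps)

lemma partition_weight_Cons_Cons:
  "a \<notin> set p \<Longrightarrow>
    partition_weight (a # a # p) = var_x ^ 2 * var_y * var_q ^ (2 * a) * partition_weight p"
  by (simp add: partition_weight_def num_repeated_Cons_Cons power_add algebra_simps
      power2_eq_square power_mult)

lemma mult_var_q_power_nth: "(f * var_q ^ m) $ n = (if n < m then 0 else f $ (n - m))"
  unfolding var_q_def by (rule fps_X_power_mult_right_nth)

lemma partition_weight_nth: "sum_list p \<noteq> n \<Longrightarrow> partition_weight p $ n = 0"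
proof -
  assume "sum_list p \<noteq> n"
  \<comment> \<open>The variables \<open>x\<close> and \<open>y\<close> live in the coefficient
    ring, so this factor is constant in \<open>q\<close> and the weight sits in the single degree
    \<open>sum_list p\<close>.\<close>
  moreover have "var_x ^ length p * var_y ^ num_repeated 2 p =
      fps_const (fps_X ^ length p * fps_const fps_X ^ num_repeated 2 p)"
    unfolding var_x_def var_y_def by (simp add: fps_const_power)
  ultimately show ?thesis
    unfolding partition_weight_def by (simp only: mult_var_q_power_nth) auto
qed

lemma finite_sum_list_eq: "finite {p :: nat list. (\<forall>a\<in>set p. 0 < a) \<and> sum_list p = n}"
proof (rule finite_subset)
  show "{p. (\<forall>a\<in>set p. 0 < a) \<and> sum_list p = n} \<subseteq> {p. set p \<subseteq> {..n} \<and> length p \<le> n}"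
  proof safe
    fix p :: "nat list" and a assume "a \<in> set p"
    thus "a \<le> sum_list p" by (auto intro: member_le_sum_list)
  next
    fix p :: "nat list" assume "\<forall>a\<in>set p. 0 < a"
    thus "length p \<le> sum_list p" by (induction p) auto
  qed
qed (rule finite_lists_length_le, simp)

lemma partition_weight_summable: "partition_weight summable_on parts_above k i"
proof (rule fps_summable_on)
  fix n
  show "finite {p \<in> parts_above k i. partition_weight p $ n \<noteq> 0}"
    by (rule finite_subset[OF _ finite_sum_list_eq[of n]])
      (use partition_weight_nth in \<open>fastforce simp: parts_above_def\<close>)
qed

text \<open>This is \<open>G k i\<close> of the overview. Since \<open>infsum\<close> defaults to 0
  on families without a sum, its meaning rests on \<open>partition_weight_summable\<close>.\<close>

definition part_gf :: "nat \<Rightarrow> nat \<Rightarrow> fps3" where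
  "part_gf k i = infsum partition_weight (parts_above k i)"

lemma part_gf_has_sum: "(partition_weight has_sum part_gf k i) (parts_above k i)"
  unfolding part_gf_def by (rule has_sum_infsum[OF partition_weight_summable])

lemma part_gf_0: "part_gf k 0 = part_gf (Suc k) 2"
  by (simp add: part_gf_def parts_above_0)

lemma part_gf_1:
  "part_gf k 1 = part_gf (Suc k) 2 + var_x * var_q ^ Suc k * part_gf (Suc k) 1"
proof -
  let ?h = "(#) (Suc k)"
  have "((\<lambda>p. var_x * var_q ^ Suc k * partition_weight p) has_sum
      var_x * var_q ^ Suc k * part_gf (Suc k) 1) (parts_above (Suc k) 1)"
    by (intro has_sum_cmult_right part_gf_has_sum)
  also have "?this \<longleftrightarrow> ((partition_weight \<circ> ?h) has_sum
      var_x * var_q ^ Suc k * part_gf (Suc k) 1) (parts_above (Suc k) 1)"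
  proof (rule has_sum_cong)
    fix p assume "p \<in> parts_above (Suc k) 1"
    hence "Suc k \<notin> set p" by (auto simp: parts_above_def)
    thus "var_x * var_q ^ Suc k * partition_weight p = (partition_weight \<circ> ?h) p"
      unfolding o_def by (rule partition_weight_Cons[symmetric])
  qed
  finally have "(partition_weight has_sum var_x * var_q ^ Suc k * part_gf (Suc k) 1)
      (?h ` parts_above (Suc k) 1)"
    by (subst has_sum_reindex) (auto simp: inj_on_def)
  \<comment> \<open>The union is disjoint because only members of the image contain
    \<open>k + 1\<close>.\<close>
  hence "(partition_weight has_sum part_gf (Suc k) 2 + var_x * var_q ^ Suc k * part_gf (Suc k) 1)
      (parts_above k 1)"
    unfolding parts_above_1[of k]
    by (intro has_sum_Un_disjoint part_gf_has_sum) (auto simp: parts_above_def)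
  thus ?thesis using part_gf_has_sum has_sum_unique by blast
qed

lemma part_gf_2:
  "part_gf k 2 =
     part_gf k 1 + var_x ^ 2 * var_y * var_q ^ (2 * Suc k) * part_gf (Suc (Suc k)) 2"
proof -
  let ?h = "\<lambda>r. Suc k # Suc k # r"
  let ?c = "var_x ^ 2 * var_y * var_q ^ (2 * Suc k)"
  have "((\<lambda>p. ?c * partition_weight p) has_sum ?c * part_gf (Suc (Suc k)) 2)
      (parts_above (Suc (Suc k)) 2)"
    by (intro has_sum_cmult_right part_gf_has_sum)
  also have "?this \<longleftrightarrow> ((partition_weight \<circ> ?h) has_sum
      ?c * part_gf (Suc (Suc k)) 2) (parts_above (Suc (Suc k)) 2)"
  proof (rule has_sum_cong)
    fix p assume "p \<in> parts_above (Suc (Suc k)) 2"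
    hence "Suc k \<notin> set p" by (auto simp: parts_above_def)
    thus "?c * partition_weight p = (partition_weight \<circ> ?h) p"
      unfolding o_def by (rule partition_weight_Cons_Cons[symmetric])
  qed
  finally have "(partition_weight has_sum ?c * part_gf (Suc (Suc k)) 2)
      (?h ` parts_above (Suc (Suc k)) 2)"
    by (subst has_sum_reindex) (auto simp: inj_on_def)
  \<comment> \<open>Disjoint again: members of the image contain \<open>k + 1\<close> at least
    twice, the others at most once.\<close>
  hence "(partition_weight has_sum part_gf k 1 + ?c * part_gf (Suc (Suc k)) 2) (parts_above k 2)"
    unfolding parts_above_2[of k]
    by (intro has_sum_Un_disjoint part_gf_has_sum) (auto simp: parts_above_def)
  thus ?thesis using part_gf_has_sum has_sum_unique by blast
qed

text \<open>The first part of a nonempty partition in the set already exceeds \<open>k\<close>,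
  hence \<open>n\<close>, so only the empty partition contributes.\<close>

lemma part_gf_nth:
  assumes "n \<le> k"
  shows "part_gf k i $ n = (1 :: fps3) $ n"
proof -
  have "part_gf k i $ n = partition_weight [] $ n"
  proof (rule fps_has_sum_nth_single[OF part_gf_has_sum])
    fix p assume p: "p \<in> parts_above k i" "p \<noteq> []"
    then obtain a r where "p = a # r" by (cases p) auto
    hence "sum_list p \<noteq> n" using p assms by (auto simp: parts_above_def)
    thus "partition_weight p $ n = 0" by (rule partition_weight_nth)
  qed (simp add: parts_above_def)
  thus ?thesis by (simp add: partition_weight_def num_repeated_def)
qed

section \<open>The double sums\<close>

definition double_term :: "nat \<Rightarrow> nat \<Rightarrow> nat \<times> nat \<Rightarrow> fps3" where
  "double_term a b = (\<lambda>(n1, n2).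
     var_x ^ (n1 + 2 * n2) * var_y ^ n2
       * var_q ^ ((n1 choose 2) + 4 * (n2 choose 2) + 2 * n1 * n2 + a * n1 + b * n2)
     / (q_pochhammer var_q var_q n1 * q_pochhammer (var_q ^ 2) (var_q ^ 2) n2))"

text \<open>The coefficients form a domain but not a field; constant coefficient 1 makes the
  quotient exact, and cancellation then makes it unique.\<close>

lemma fps3_divide_eq_iff:
  fixes f g h :: fps3
  assumes "g $ 0 = 1"
  shows "f / g = h \<longleftrightarrow> f = h * g"
proof -
  have "g \<noteq> 0" using assms by auto
  moreover have "f / g * g = f" using assms by (rule fps3_divide_times)
  ultimately show ?thesis by (metis mult_right_cancel)
qed

lemma fps3_mult_divide:
  fixes f g h :: fps3
  assumes "g $ 0 = 1"
  shows "f * h / g = f / g * h"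
proof -
  have "f / g * h * g = f / g * g * h" by (simp only: mult_ac)
  also have "\<dots> = f * h" by (simp only: fps3_divide_times[OF assms])
  finally show ?thesis by (simp only: fps3_divide_eq_iff[OF assms])
qed

lemma q_pochhammer_Suc:
  "q_pochhammer (r::'a::comm_ring_1) r (Suc n) = q_pochhammer r r n * (1 - r ^ Suc n)"
  by (simp add: q_pochhammer_def)

lemma denominator_nth_0:
  "(q_pochhammer var_q var_q n1 * q_pochhammer (var_q ^ 2) (var_q ^ 2) n2) $ 0 = 1"
  using q_pochhammer_nth_0[of 1 n1] q_pochhammer_nth_0[of 2 n2] by simp

lemma double_term_times:
  "double_term a b (n1, n2) * (q_pochhammer var_q var_q n1 * q_pochhammer (var_q ^ 2) (var_q ^ 2) n2)
    = var_x ^ (n1 + 2 * n2) * var_y ^ n2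
       * var_q ^ ((n1 choose 2) + 4 * (n2 choose 2) + 2 * n1 * n2 + a * n1 + b * n2)"
  unfolding double_term_def prod.case by (rule fps3_divide_times[OF denominator_nth_0])

lemma choose_two_Suc: "Suc n choose 2 = (n choose 2) + n"
  by (simp add: numeral_2_eq_2)

text \<open>Raising \<open>a\<close> by 1 multiplies the term at \<open>Suc n1\<close> by
  \<open>q^(n1 + 1)\<close>, so the difference carries \<open>1 - q^(n1 + 1)\<close>, which cancels
  the last denominator factor. In the exponent, the binomial adds \<open>n1\<close> and the mixed
  product adds \<open>2 n2\<close>: hence \<open>Suc a\<close>, \<open>b + 2\<close> and the factor
  \<open>q^a\<close>.\<close>

lemma double_term_step_fst:
  "double_term a b (Suc n1, n2) =
     double_term (Suc a) b (Suc n1, n2) + var_x * var_q ^ a * double_term (Suc a) (b + 2) (n1, n2)"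
proof -
  let ?D = "q_pochhammer var_q var_q n1 * q_pochhammer (var_q ^ 2) (var_q ^ 2) n2"
  let ?D' = "q_pochhammer var_q var_q (Suc n1) * q_pochhammer (var_q ^ 2) (var_q ^ 2) n2"
  have D': "?D' = ?D * (1 - var_q ^ Suc n1)"
    by (simp add: q_pochhammer_Suc algebra_simps)
  have "?D' \<noteq> 0" using denominator_nth_0[of "Suc n1" n2] by auto
  moreover have "double_term a b (Suc n1, n2) * ?D' = (double_term (Suc a) b (Suc n1, n2) +
      var_x * var_q ^ a * double_term (Suc a) (b + 2) (n1, n2)) * ?D'"
  proof -
    have *: "var_x * var_q ^ a * double_term (Suc a) (b + 2) (n1, n2) * ?D' =
       var_x * var_q ^ a * (1 - var_q ^ Suc n1) * (double_term (Suc a) (b + 2) (n1, n2) * ?D)"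
      unfolding D' by (simp only: mult_ac)
    let ?e = "(n1 choose 2) + 4 * (n2 choose 2) + 2 * n1 * n2 + Suc a * n1 + (b + 2) * n2"
    \<comment> \<open>Both numerators on the shifted index are expressed through the numerator
      exponent \<open>?e\<close> of the unshifted term.\<close>
    have q: "var_q ^ ((Suc n1 choose 2) + 4 * (n2 choose 2) + 2 * Suc n1 * n2 + a * Suc n1 + b * n2)
        = var_q ^ a * var_q ^ ?e"
      "var_q ^ ((Suc n1 choose 2) + 4 * (n2 choose 2) + 2 * Suc n1 * n2 + Suc a * Suc n1 + b * n2)
        = var_q ^ a * var_q ^ Suc n1 * var_q ^ ?e"
      unfolding power_add[symmetric]
      by (rule arg_cong[of _ _ "power var_q"], simp add: choose_two_Suc algebra_simps)+
    have x: "var_x ^ (Suc n1 + 2 * n2) = var_x * var_x ^ (n1 + 2 * n2)" by simp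
    show ?thesis
      unfolding distrib_right * double_term_times q x by (simp only: ring_distribs mult_ac) simp
  qed
  ultimately show ?thesis by (metis mult_right_cancel)
qed

text \<open>The same cancellation with \<open>1 - q^(2 (n2 + 1))\<close>, which is why
  \<open>b\<close> is raised by 2. Here four times the binomial adds \<open>4 n2\<close> and the
  mixed product adds \<open>2 n1\<close>, giving \<open>a + 2\<close> and
  \<open>b + 4\<close>.\<close>

lemma double_term_step_snd:
  "double_term a b (n1, Suc n2) =
     double_term a (b + 2) (n1, Suc n2) +
     var_x ^ 2 * var_y * var_q ^ b * double_term (a + 2) (b + 4) (n1, n2)"
proof -
  let ?D = "q_pochhammer var_q var_q n1 * q_pochhammer (var_q ^ 2) (var_q ^ 2) n2"
  let ?D' = "q_pochhammer var_q var_q n1 * q_pochhammer (var_q ^ 2) (var_q ^ 2) (Suc n2)"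
  let ?c = "var_x ^ 2 * var_y * var_q ^ b"
  have D': "?D' = ?D * (1 - (var_q ^ 2) ^ Suc n2)"
    by (simp add: q_pochhammer_Suc algebra_simps)
  have "?D' \<noteq> 0" using denominator_nth_0[of n1 "Suc n2"] by auto
  moreover have "double_term a b (n1, Suc n2) * ?D' = (double_term a (b + 2) (n1, Suc n2) +
      ?c * double_term (a + 2) (b + 4) (n1, n2)) * ?D'"
  proof -
    have *: "?c * double_term (a + 2) (b + 4) (n1, n2) * ?D' =
       ?c * (1 - (var_q ^ 2) ^ Suc n2) * (double_term (a + 2) (b + 4) (n1, n2) * ?D)"
      unfolding D' by (simp only: mult_ac)
    let ?e = "(n1 choose 2) + 4 * (n2 choose 2) + 2 * n1 * n2 + (a + 2) * n1 + (b + 4) * n2"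
    have q: "var_q ^ ((n1 choose 2) + 4 * (Suc n2 choose 2) + 2 * n1 * Suc n2 + a * n1 + b * Suc n2)
        = var_q ^ b * var_q ^ ?e"
      "var_q ^ ((n1 choose 2) + 4 * (Suc n2 choose 2) + 2 * n1 * Suc n2 + a * n1 + (b + 2) * Suc n2)
        = var_q ^ b * (var_q ^ 2) ^ Suc n2 * var_q ^ ?e"
      unfolding power_add[symmetric] power_mult[symmetric]
      by (rule arg_cong[of _ _ "power var_q"], simp add: choose_two_Suc algebra_simps)+
    have x: "var_x ^ (n1 + 2 * Suc n2) = var_x ^ 2 * var_x ^ (n1 + 2 * n2)"
      unfolding power_add[symmetric] by (rule arg_cong[of _ _ "power var_x"]) simp
    have y: "var_y ^ Suc n2 = var_y * var_y ^ n2" by simp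
    show ?thesis
      unfolding distrib_right[of _ _ ?D'] * double_term_times q x y
      by (simp only: ring_distribs mult_ac) simp
  qed
  ultimately show ?thesis by (metis mult_right_cancel)
qed

text \<open>Covers the indices that the shifts do not reach: a zero index annihilates its linear
  coefficient.\<close>

lemma double_term_boundary:
  "double_term a b (0, n2) = double_term a' b (0, n2)"
  "double_term a b (n1, 0) = double_term a b' (n1, 0)"
  by (simp_all add: double_term_def)

lemma double_term_nth:
  assumes "n < a * n1 + b * n2"
  shows "double_term a b (n1, n2) $ n = 0"
proof -
  let ?D = "q_pochhammer var_q var_q n1 * q_pochhammer (var_q ^ 2) (var_q ^ 2) n2"
  let ?e = "(n1 choose 2) + 4 * (n2 choose 2) + 2 * n1 * n2 + a * n1 + b * n2"
  let ?u = "var_x ^ (n1 + 2 * n2) * var_y ^ n2"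
  \<comment> \<open>Pulling the power of \<open>q\<close> out of the quotient shows that all degrees
    below \<open>?e\<close> vanish, and \<open>?e\<close> is at least the linear part.\<close>
  have "double_term a b (n1, n2) = ?u / ?D * var_q ^ ?e"
    unfolding double_term_def prod.case by (rule fps3_mult_divide[OF denominator_nth_0])
  thus ?thesis using assms by (simp add: mult_var_q_power_nth)
qed

lemma double_term_summable:
  assumes "0 < a" "0 < b"
  shows "double_term a b summable_on A"
proof (rule fps_summable_on)
  fix n
  have *: "n1 \<le> n \<and> n2 \<le> n" if "double_term a b (n1, n2) $ n \<noteq> 0" for n1 n2
  proof -
    have "a * n1 + b * n2 \<le> n" using that double_term_nth not_less by blast
    moreover have "n1 \<le> a * n1" "n2 \<le> b * n2" using assms by auto
    ultimately show ?thesis by linarith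
  qed
  show "finite {p\<in>A. double_term a b p $ n \<noteq> 0}"
    by (rule finite_subset[of _ "{..n} \<times> {..n}"]) (auto dest: *)
qed

section \<open>Recurrences and initial values of the double sums\<close>

definition double_gf :: "nat \<Rightarrow> nat \<Rightarrow> fps3" where
  "double_gf a b = infsum (double_term a b) UNIV"

lemma double_gf_has_sum: "0 < a \<Longrightarrow> 0 < b \<Longrightarrow> (double_term a b has_sum double_gf a b) UNIV"
  unfolding double_gf_def by (intro has_sum_infsum double_term_summable)

text \<open>Lifts a termwise recurrence along an injective index shift \<open>h\<close> to the sums;
  off the range of \<open>h\<close> the correction term is absent.\<close>

lemma has_sum_shift:
  fixes g :: "'a \<Rightarrow> 'b::{topological_semigroup_mult, topological_comm_monoid_add, semiring_0, t2_space}"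
  assumes f: "(f has_sum F) UNIV" and f': "(f' has_sum F') UNIV" and g: "(g has_sum G) UNIV"
    and "inj h"
    and step: "\<And>x. f (h x) = f' (h x) + c * g x"
    and boundary: "\<And>y. y \<notin> range h \<Longrightarrow> f y = f' y"
  shows "F = F' + c * G"
proof -
  \<comment> \<open>Extending the correction by 0 turns the sum over the range of \<open>h\<close>
    into one over all indices.\<close>
  define r where "r y = (if y \<in> range h then c * g (inv h y) else 0)" for y
  have "((\<lambda>x. c * g x) has_sum c * G) UNIV" using g by (rule has_sum_cmult_right)
  also have "(\<lambda>x. c * g x) = r \<circ> h" using \<open>inj h\<close> by (auto simp: r_def)
  finally have *: "(r \<circ> h has_sum c * G) UNIV" .
  have "(r has_sum c * G) (range h)"
    using \<open>inj h\<close> * by (rule iffD2[OF has_sum_reindex])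
  also have "?this \<longleftrightarrow> (r has_sum c * G) UNIV"
    by (rule has_sum_cong_neutral) (auto simp: r_def)
  finally have "((\<lambda>y. f' y + r y) has_sum F' + c * G) UNIV" by (intro has_sum_add f')
  moreover have "f y = f' y + r y" for y
    using \<open>inj h\<close> step boundary by (cases "y \<in> range h") (auto simp: r_def)
  hence "f = (\<lambda>y. f' y + r y)" by blast
  ultimately show ?thesis using f has_sum_unique by metis
qed

lemma double_gf_step_fst:
  assumes "0 < a" "0 < b"
  shows "double_gf a b = double_gf (Suc a) b + var_x * var_q ^ a * double_gf (Suc a) (b + 2)"
proof (rule has_sum_shift[where h = "\<lambda>(n1, n2). (Suc n1, n2)"])
  show "double_term a b ((\<lambda>(n1, n2). (Suc n1, n2)) x) =
      double_term (Suc a) b ((\<lambda>(n1, n2). (Suc n1, n2)) x) +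
      var_x * var_q ^ a * double_term (Suc a) (b + 2) x" for x
    by (cases x) (simp only: prod.case double_term_step_fst[of a b])
  fix y :: "nat \<times> nat" assume y: "y \<notin> range (\<lambda>(n1, n2). (Suc n1, n2))"
  obtain n1 n2 where [simp]: "y = (n1, n2)" by force
  have "n1 = 0" using y by (cases n1) (auto simp: image_iff)
  thus "double_term a b y = double_term (Suc a) b y" using double_term_boundary(1) by simp
qed (use assms in \<open>auto intro!: double_gf_has_sum inj_onI\<close>)

lemma double_gf_step_snd:
  assumes "0 < a" "0 < b"
  shows "double_gf a b =
    double_gf a (b + 2) + var_x ^ 2 * var_y * var_q ^ b * double_gf (a + 2) (b + 4)"
proof (rule has_sum_shift[where h = "\<lambda>(n1, n2). (n1, Suc n2)"])
  show "double_term a b ((\<lambda>(n1, n2). (n1, Suc n2)) x) =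
      double_term a (b + 2) ((\<lambda>(n1, n2). (n1, Suc n2)) x) +
      var_x ^ 2 * var_y * var_q ^ b * double_term (a + 2) (b + 4) x" for x
    by (cases x) (simp only: prod.case double_term_step_snd[of a b])
  fix y :: "nat \<times> nat" assume y: "y \<notin> range (\<lambda>(n1, n2). (n1, Suc n2))"
  obtain n1 n2 where [simp]: "y = (n1, n2)" by force
  have "n2 = 0" using y by (cases n2) (auto simp: image_iff)
  thus "double_term a b y = double_term a (b + 2) y" using double_term_boundary(2) by simp
qed (use assms in \<open>auto intro!: double_gf_has_sum inj_onI\<close>)

lemma double_gf_nth:
  assumes "n < a" "n < b"
  shows "double_gf a b $ n = (1 :: fps3) $ n"
proof -
  have "double_gf a b $ n = double_term a b (0, 0) $ n"
  proof (rule fps_has_sum_nth_single[OF double_gf_has_sum])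
    fix p :: "nat \<times> nat" assume "p \<noteq> (0, 0)"
    then obtain n1 n2 where p: "p = (n1, n2)" "0 < n1 \<or> 0 < n2" by (cases p) auto
    have "n < a * n1 + b * n2"
      using p(2)
    proof
      assume "0 < n1"
      hence "a \<le> a * n1" by simp
      thus ?thesis using assms by linarith
    next
      assume "0 < n2"
      hence "b \<le> b * n2" by simp
      thus ?thesis using assms by linarith
    qed
    thus "double_term a b p $ n = 0" using p double_term_nth by blast
  qed (use assms in auto)
  moreover have "double_term a b (0, 0) = 1"
    unfolding double_term_def prod.case
    by (subst fps3_divide_eq_iff[OF denominator_nth_0]) (simp add: q_pochhammer_def binomial_eq_0)
  ultimately show ?thesis by simp
qed

section \<open>Uniqueness of the solution\<close>

lemma recurrence_unique:
  fixes A1 A2 B1 B2 :: "nat \<Rightarrow> fps3"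
  assumes A1: "\<And>k. A1 k = A2 (Suc k) + var_x * var_q ^ Suc k * A1 (Suc k)"
    and A2: "\<And>k. A2 k = A1 k + var_x ^ 2 * var_y * var_q ^ (2 * Suc k) * A2 (Suc (Suc k))"
    and B1: "\<And>k. B1 k = B2 (Suc k) + var_x * var_q ^ Suc k * B1 (Suc k)"
    and B2: "\<And>k. B2 k = B1 k + var_x ^ 2 * var_y * var_q ^ (2 * Suc k) * B2 (Suc (Suc k))"
    and init: "\<And>n k. n \<le> k \<Longrightarrow> A1 k $ n = B1 k $ n" "\<And>n k. n \<le> k \<Longrightarrow> A2 k $ n = B2 k $ n"
  shows "A1 k = B1 k" "A2 k = B2 k"
proof -
  have nth_1: "(f + var_x * var_q ^ m * g) $ n = f $ n + (if n < m then 0 else fps_X * g $ (n - m))"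
    for f g :: fps3 and m n
  proof -
    have "var_x * var_q ^ m * g = fps_const fps_X * g * var_q ^ m"
      unfolding var_x_def by (simp only: mult_ac)
    thus ?thesis by (simp only: fps_add_nth mult_var_q_power_nth fps_mult_left_const_nth)
  qed
  have nth_2: "(f + var_x ^ 2 * var_y * var_q ^ m * g) $ n =
      f $ n + (if n < m then 0 else fps_X ^ 2 * fps_const fps_X * g $ (n - m))"
    for f g :: fps3 and m n
  proof -
    have "var_x ^ 2 * var_y * var_q ^ m * g = fps_const (fps_X ^ 2 * fps_const fps_X) * g * var_q ^ m"
      unfolding var_x_def var_y_def by (simp add: fps_const_power mult_ac)
    thus ?thesis by (simp only: fps_add_nth mult_var_q_power_nth fps_mult_left_const_nth)
  qed
  have "A1 k $ n = B1 k $ n \<and> A2 k $ n = B2 k $ n" for k n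
  proof (induction "n - k" arbitrary: n k rule: less_induct)
    case less
    show ?case
    proof (cases "n \<le> k")
      case True
      thus ?thesis using init by blast
    next
      case False
      \<comment> \<open>Every term at \<open>Suc k\<close> or \<open>Suc (Suc k)\<close> has smaller
        difference: \<open>l\<close> grows and \<open>m\<close> never exceeds \<open>n\<close>.
        Truncation at 0 is harmless since here \<open>k < n\<close>.\<close>
      have IH: "A1 l $ m = B1 l $ m" "A2 l $ m = B2 l $ m" if "m - l < n - k" for l m
        using less[OF that] by blast+
      have 1: "A1 k $ n = B1 k $ n"
        unfolding A1[of k] B1[of k] nth_1 using False by (simp add: IH)
      \<comment> \<open>The recurrence of \<open>A2 k\<close> refers to \<open>A1\<close> at the
        same \<open>k\<close>, beyond the induction hypothesis; the equality just shown fills this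
        in.\<close>
      moreover have "A2 k $ n = B2 k $ n"
        unfolding A2[of k] B2[of k] nth_2 using False by (simp add: IH 1)
      ultimately show ?thesis by blast
    qed
  qed
  thus "A1 k = B1 k" "A2 k = B2 k" by (simp_all add: fps_eq_iff)
qed

lemma part_gf_eq_double_gf:
  "part_gf k 1 = double_gf (1 + k) (4 + 2 * k)" "part_gf k 2 = double_gf (1 + k) (2 + 2 * k)"
proof -
  \<comment> \<open>The split produces the linear parts \<open>(2 + k, 4 + 2 k)\<close> and
    \<open>(2 + k, 6 + 2 k)\<close>, which are those of the two families at
    \<open>Suc k\<close>.\<close>
  have *: "double_gf (1 + k) (4 + 2 * k) = double_gf (1 + Suc k) (2 + 2 * Suc k) +
      var_x * var_q ^ Suc k * double_gf (1 + Suc k) (4 + 2 * Suc k)" for k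
    using double_gf_step_fst[of "1 + k" "4 + 2 * k"] by (simp add: eval_nat_numeral)
  have **: "double_gf (1 + k) (2 + 2 * k) = double_gf (1 + k) (4 + 2 * k) +
      var_x ^ 2 * var_y * var_q ^ (2 * Suc k) * double_gf (1 + Suc (Suc k)) (2 + 2 * Suc (Suc k))"
    for k
    using double_gf_step_snd[of "1 + k" "2 + 2 * k"] by (simp add: eval_nat_numeral)
  have init: "part_gf k 1 $ n = double_gf (1 + k) (4 + 2 * k) $ n"
    "part_gf k 2 $ n = double_gf (1 + k) (2 + 2 * k) $ n" if "n \<le> k" for n k
    using that by (simp_all add: part_gf_nth double_gf_nth)
  show "part_gf k 1 = double_gf (1 + k) (4 + 2 * k)" "part_gf k 2 = double_gf (1 + k) (2 + 2 * k)"
    by (rule recurrence_unique[where ?A1.0 = "\<lambda>k. part_gf k 1" and ?A2.0 = "\<lambda>k. part_gf k 2"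
          and ?B1.0 = "\<lambda>k. double_gf (1 + k) (4 + 2 * k)"
          and ?B2.0 = "\<lambda>k. double_gf (1 + k) (2 + 2 * k)",
          OF part_gf_1 part_gf_2 * ** init]; assumption)+
qed

theorem theorem1p4:
  shows "(\<exists>F. (partition_weight has_sum F) (gf_partitions 2) \<and>
      ((\<lambda>(n1, n2).
          var_x ^ (n1 + 2 * n2) * var_y ^ n2
            * var_q ^ ((n1 choose 2) + 4 * (n2 choose 2) + 2 * n1 * n2 + n1 + 2 * n2)
          / (q_pochhammer var_q var_q n1 * q_pochhammer (var_q ^ 2) (var_q ^ 2) n2))
        has_sum F) UNIV)
    \<and> (\<exists>F. (partition_weight has_sum F) (gf_partitions_ones 2 1) \<and>
      ((\<lambda>(n1, n2).
          var_x ^ (n1 + 2 * n2) * var_y ^ n2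
            * var_q ^ ((n1 choose 2) + 4 * (n2 choose 2) + 2 * n1 * n2 + n1 + 4 * n2)
          / (q_pochhammer var_q var_q n1 * q_pochhammer (var_q ^ 2) (var_q ^ 2) n2))
        has_sum F) UNIV)
    \<and> (\<exists>F. (partition_weight has_sum F) (gf_partitions_ones 2 0) \<and>
      ((\<lambda>(n1, n2).
          var_x ^ (n1 + 2 * n2) * var_y ^ n2
            * var_q ^ ((n1 choose 2) + 4 * (n2 choose 2) + 2 * n1 * n2 + 2 * n1 + 4 * n2)
          / (q_pochhammer var_q var_q n1 * q_pochhammer (var_q ^ 2) (var_q ^ 2) n2))
        has_sum F) UNIV)"
proof -
  have "(partition_weight has_sum double_gf 1 2) (gf_partitions 2)"
    using part_gf_has_sum[of 0 2] part_gf_eq_double_gf(2)[of 0] by (simp add: gf_partitions_eq)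
  moreover have "(partition_weight has_sum double_gf 1 4) (gf_partitions_ones 2 1)"
    using part_gf_has_sum[of 0 1] part_gf_eq_double_gf(1)[of 0]
    by (simp add: gf_partitions_ones_eq)
  \<comment> \<open>Forbidding the part 1 turns \<open>G 0 0\<close> into \<open>G 1 2\<close>,
    whose linear part at \<open>k = 1\<close> is \<open>(2, 4)\<close>.\<close>
  moreover have "(partition_weight has_sum double_gf 2 4) (gf_partitions_ones 2 0)"
    using part_gf_has_sum[of 0 0] part_gf_eq_double_gf(2)[of 1]
    unfolding gf_partitions_ones_eq by (simp add: part_gf_0 eval_nat_numeral)
  ultimately show ?thesis
    using double_gf_has_sum[of 1 2] double_gf_has_sum[of 1 4] double_gf_has_sum[of 2 4]
    unfolding double_term_def mult_1 by (intro conjI exI) auto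
qed

end
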